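(* Let $n\ge1$ and let $\langle n,n,n\rangle=\sum_{i,j,k=1}^n e_{(i,j)}\otimes e_{(j,k)}\otimes e_{(k,i)}\in\bigotimes^3\mathbb{C}^{n\times n}$ be the matrix multiplication tensor. Then $$F_n(\langle n,n,n\rangle)=\sum_{\mu,\nu,\pi\colon[n]^3\to[n]}\mathrm{sgn}_x(\mu,\nu)\,\mathrm{sgn}_y(\nu,\pi)\,\mathrm{sgn}_z(\pi,\mu),$$ where the sum is over all triples of maps $\mu,\nu,\pi\colon[n]^3\to[n]$.
   Context: $[k]=\{1,\dots,k\}$. The basis of $\mathbb{C}^{n\times n}=\mathbb{C}^{n^2}$ is indexed by $[n]^2$, identified with $[n^2]$ by a fixed ordering. A total ordering of $[n]^3$ is fixed. The $x$-slices (resp. $y$-, $z$-slices) of $[n]^3$ are the $n$ subsets obtained by fixing the first (resp. second, third) coordinate, with the induced ordering. For a labeling $\alpha\colon[n]^3\to[n^2]\cong[n]^2$, $\mathrm{sgn}_x(\alpha)$ is the product of the signs of the permutations given by the restrictions of $\alpha$ to the $x$-slices if all these restrictions are bijections onto $[n^2]$, and $0$ otherwise; $\mathrm{sgn}_y,\mathrm{sgn}_z$ are analogous. For maps $\mu,\nu\colon[n]^3\to[n]$, $(\mu,\nu)$ denotes the labeling $p\mapsto(\mu(p),\nu(p))\in[n]^2$. For $w=\sum_{a,b,c}w_{abc}\,e_a\otimes e_b\otimes e_c\in\bigotimes^3\mathbb{C}^{n^2}$, $$F_n(w)=\sum_{\alpha,\beta,\gamma\colon[n]^3\to[n^2]}\mathrm{sgn}_x(\alpha)\,\mathrm{sgn}_y(\beta)\,\mathrm{sgn}_z(\gamma)\prod_{p\in[n]^3}w_{\alpha(p)\beta(p)\gamma(p)}.$$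 *)

theory Defs
  imports Complex_Main "HOL-Library.FuncSet" "HOL-Combinatorics.Permutations"
begin

text \<open>
  The two fixed choices enter as explicit parameters: \<open>\<phi>\<close> is the identification of
  \<open>[n] \<times> [n]\<close> with \<open>[n\<^sup>2]\<close>, and \<open>r\<close> is the (reflexive) total order on \<open>[n]\<^sup>3\<close>, as a relation.
  Maps out of \<open>[n]\<^sup>3\<close> are elements of \<open>PiE\<close> sets, so that distinct functions are distinct maps.
\<close>

abbreviation cube :: "nat \<Rightarrow> (nat \<times> nat \<times> nat) set"
  where "cube n \<equiv> {1..n} \<times> {1..n} \<times> {1..n}"

definition slice :: "nat \<Rightarrow> (nat \<times> nat \<times> nat \<Rightarrow> nat) \<Rightarrow> nat \<Rightarrow> (nat \<times> nat \<times> nat) set"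
  where "slice n coord i = {p \<in> cube n. coord p = i}"

definition rank_in :: "'a rel \<Rightarrow> 'a set \<Rightarrow> 'a \<Rightarrow> nat"
  where "rank_in r S p = card {q \<in> S. (q, p) \<in> r}"

text \<open>
  \<open>inv_into S (rank_in r S)\<close> lists \<open>S\<close> increasingly by \<open>1, \<dots>, card S\<close>. If \<open>\<alpha>\<close> maps \<open>S\<close>
  bijectively onto \<open>{1..card S}\<close>, then \<open>k \<mapsto> \<alpha> (k-th element of S)\<close> is a permutation of
  \<open>{1..card S}\<close>, whose sign this is.
\<close>

definition restriction_sign :: "'a rel \<Rightarrow> 'a set \<Rightarrow> ('a \<Rightarrow> nat) \<Rightarrow> int"
  where "restriction_sign r S \<alpha> = sign_on {1..card S} (\<alpha> \<circ> inv_into S (rank_in r S))"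

definition sgn_along ::
  "(nat \<times> nat \<times> nat \<Rightarrow> nat) \<Rightarrow> nat \<Rightarrow> (nat \<times> nat \<times> nat) rel \<Rightarrow> (nat \<times> nat \<times> nat \<Rightarrow> nat) \<Rightarrow> int"
  where "sgn_along coord n r \<alpha> =
    (if \<forall>i\<in>{1..n}. bij_betw \<alpha> (slice n coord i) {1..n\<^sup>2}
     then \<Prod>i\<in>{1..n}. restriction_sign r (slice n coord i) \<alpha>
     else 0)"

abbreviation "sgn_x \<equiv> sgn_along fst"
abbreviation "sgn_y \<equiv> sgn_along (\<lambda>p. fst (snd p))"
abbreviation "sgn_z \<equiv> sgn_along (\<lambda>p. snd (snd p))"

definition pair_labeling ::
  "nat \<Rightarrow> (nat \<times> nat \<Rightarrow> nat) \<Rightarrow> (nat \<times> nat \<times> nat \<Rightarrow> nat) \<Rightarrow> (nat \<times> nat \<times> nat \<Rightarrow> nat)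
    \<Rightarrow> nat \<times> nat \<times> nat \<Rightarrow> nat"
  where "pair_labeling n \<phi> \<mu> \<nu> = (\<lambda>p\<in>cube n. \<phi> (\<mu> p, \<nu> p))"

text \<open>
  A tensor in the third tensor power of \<open>\<complex>\<^bsup>m\<^esup>\<close> is given by its coordinates
  \<open>w a b c\<close> for \<open>a, b, c \<in> {1..m}\<close>.
\<close>

type_synonym tensor3 = "nat \<Rightarrow> nat \<Rightarrow> nat \<Rightarrow> complex"

definition basis_vec :: "nat \<Rightarrow> nat \<Rightarrow> complex"
  where "basis_vec a = (\<lambda>b. if b = a then 1 else 0)"

definition tensor_prod3 ::
  "(nat \<Rightarrow> complex) \<Rightarrow> (nat \<Rightarrow> complex) \<Rightarrow> (nat \<Rightarrow> complex) \<Rightarrow> tensor3"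
  where "tensor_prod3 u v w = (\<lambda>a b c. u a * v b * w c)"

definition matmul_tensor :: "nat \<Rightarrow> (nat \<times> nat \<Rightarrow> nat) \<Rightarrow> tensor3"
  where "matmul_tensor n \<phi> = (\<lambda>a b c. \<Sum>i\<in>{1..n}. \<Sum>j\<in>{1..n}. \<Sum>k\<in>{1..n}.
    tensor_prod3 (basis_vec (\<phi> (i, j))) (basis_vec (\<phi> (j, k))) (basis_vec (\<phi> (k, i))) a b c)"

definition fundamental_inv :: "nat \<Rightarrow> (nat \<times> nat \<times> nat) rel \<Rightarrow> tensor3 \<Rightarrow> complex"
  where "fundamental_inv n r w =
    (\<Sum>\<alpha>\<in>cube n \<rightarrow>\<^sub>E {1..n\<^sup>2}. \<Sum>\<beta>\<in>cube n \<rightarrow>\<^sub>E {1..n\<^sup>2}. \<Sum>\<gamma>\<in>cube n \<rightarrow>\<^sub>E {1..n\<^sup>2}.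
      of_int (sgn_x n r \<alpha> * sgn_y n r \<beta> * sgn_z n r \<gamma>) *
      (\<Prod>p\<in>cube n. w (\<alpha> p) (\<beta> p) (\<gamma> p)))"

end

theory Submission
  imports Defs
begin

text \<open>
  Multiplying out the product over the cells of the cube amounts to choosing a triple
  \<open>(i, j, k)\<close> for every cell independently, that is, three maps \<open>\<mu>, \<nu>, \<pi>\<close>. The term of such a
  choice is a product of Kronecker deltas, equal to \<open>1\<close> exactly when
  \<open>\<alpha> = (\<mu>, \<nu>)\<close>, \<open>\<beta> = (\<nu>, \<pi>)\<close> and \<open>\<gamma> = (\<pi>, \<mu>)\<close>, and to \<open>0\<close> otherwise
  (\<open>prod_matmul_tensor\<close>). So after exchanging the two summations, each triple of maps
  selects a single triple of labelings, whose sign product survives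
  (\<open>sum_times_fibre_count\<close>).
\<close>

lemma prod_of_bool:
  assumes "finite A"
  shows "(\<Prod>x\<in>A. of_bool (P x)) = (of_bool (\<forall>x\<in>A. P x) :: 'a::comm_semiring_1)"
  using assms by (induction A rule: finite_induct) auto

text \<open>
  The cardinality of the fibre of \<open>f\<close> over \<open>a\<close>, written as a sum of indicators, weighs \<open>s a\<close>.
  Exchanging the sums collapses the outer one to the single point \<open>f b\<close>.
\<close>
lemma sum_times_fibre_count:
  fixes s :: "'a \<Rightarrow> 'c::comm_semiring_1"
  assumes "finite A" and "f \<in> B \<rightarrow> A"
  shows "(\<Sum>a\<in>A. s a * (\<Sum>b\<in>B. of_bool (a = f b))) = (\<Sum>b\<in>B. s (f b))"
proof -
  have "(\<Sum>a\<in>A. s a * (\<Sum>b\<in>B. of_bool (a = f b))) = (\<Sum>b\<in>B. \<Sum>a\<in>A. s a * of_bool (a = f b))"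
    unfolding sum_distrib_left by (rule sum.swap)
  also have "\<dots> = (\<Sum>b\<in>B. s (f b))"
  proof (rule sum.cong[OF refl])
    fix b assume "b \<in> B"
    have "(\<Sum>a\<in>A. s a * of_bool (a = f b)) = (\<Sum>a\<in>A. if a = f b then s a else 0)"
      by (rule sum.cong) auto
    also have "\<dots> = s (f b)"
      using assms \<open>b \<in> B\<close> by (auto simp: sum.delta)
    finally show "(\<Sum>a\<in>A. s a * of_bool (a = f b)) = s (f b)" .
  qed
  finally show ?thesis .
qed

lemma pair_labeling_in_PiE:
  assumes "\<phi> \<in> {1..n} \<times> {1..n} \<rightarrow> S"
    and "\<mu> \<in> cube n \<rightarrow>\<^sub>E {1..n}" and "\<nu> \<in> cube n \<rightarrow>\<^sub>E {1..n}"
  shows "pair_labeling n \<phi> \<mu> \<nu> \<in> cube n \<rightarrow>\<^sub>E S"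
  unfolding pair_labeling_def
proof (rule restrict_PiE_iff[THEN iffD2], rule ballI)
  fix p assume "p \<in> cube n"
  then have "(\<mu> p, \<nu> p) \<in> {1..n} \<times> {1..n}"
    using assms(2,3) by (blast intro: PiE_mem)
  then show "\<phi> (\<mu> p, \<nu> p) \<in> S"
    using assms(1) by blast
qed

lemma eq_pair_labeling_iff:
  assumes "\<alpha> \<in> cube n \<rightarrow>\<^sub>E S"
  shows "\<alpha> = pair_labeling n \<phi> \<mu> \<nu> \<longleftrightarrow> (\<forall>p\<in>cube n. \<alpha> p = \<phi> (\<mu> p, \<nu> p))"
proof
  assume "\<forall>p\<in>cube n. \<alpha> p = \<phi> (\<mu> p, \<nu> p)"
  then show "\<alpha> = pair_labeling n \<phi> \<mu> \<nu>"
    unfolding pair_labeling_def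
    using assms by (intro extensionalityI[of _ "cube n"]) (auto simp: PiE_def)
qed (simp add: pair_labeling_def)

text \<open>
  Distributivity is applied to each of the three summation indices in turn; the index
  \<open>i\<close> of a cell becomes the value of \<open>\<mu>\<close> there, and likewise \<open>j\<close> and \<open>\<nu>\<close>, \<open>k\<close> and \<open>\<pi>\<close>.
  Each index occurs in two tensor factors, so each map occurs in two labelings.
\<close>
lemma prod_matmul_tensor:
  assumes "\<alpha> \<in> cube n \<rightarrow>\<^sub>E S" and "\<beta> \<in> cube n \<rightarrow>\<^sub>E S" and "\<gamma> \<in> cube n \<rightarrow>\<^sub>E S"
  shows "(\<Prod>p\<in>cube n. matmul_tensor n \<phi> (\<alpha> p) (\<beta> p) (\<gamma> p)) =
    (\<Sum>\<mu>\<in>cube n \<rightarrow>\<^sub>E {1..n}. \<Sum>\<nu>\<in>cube n \<rightarrow>\<^sub>E {1..n}. \<Sum>\<pi>\<in>cube n \<rightarrow>\<^sub>E {1..n}.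
      of_bool (\<alpha> = pair_labeling n \<phi> \<mu> \<nu> \<and> \<beta> = pair_labeling n \<phi> \<nu> \<pi>
        \<and> \<gamma> = pair_labeling n \<phi> \<pi> \<mu>))"
proof -
  have fin: "finite (cube n)"
    by simp
  have delta: "tensor_prod3 (basis_vec a) (basis_vec b) (basis_vec c) x y z =
      of_bool (x = a \<and> y = b \<and> z = c)" for a b c x y z
    by (simp add: tensor_prod3_def basis_vec_def)
  show ?thesis
    unfolding matmul_tensor_def delta
    by (simp only: prod_sum_PiE[OF fin finite_atLeastAtMost] prod_of_bool[OF fin]
        ball_conj_distrib eq_pair_labeling_iff[OF assms(1)]
        eq_pair_labeling_iff[OF assms(2)] eq_pair_labeling_iff[OF assms(3)])
qed

theorem proposition5p24:
  fixes n :: nat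
    and \<phi> :: "nat \<times> nat \<Rightarrow> nat"
    and r :: "(nat \<times> nat \<times> nat) rel"
  assumes "n \<ge> 1"
    and "bij_betw \<phi> ({1..n} \<times> {1..n}) {1..n\<^sup>2}"
    and "linear_order_on (cube n) r"
  shows "fundamental_inv n r (matmul_tensor n \<phi>) =
    of_int (\<Sum>\<mu>\<in>cube n \<rightarrow>\<^sub>E {1..n}. \<Sum>\<nu>\<in>cube n \<rightarrow>\<^sub>E {1..n}. \<Sum>\<pi>\<in>cube n \<rightarrow>\<^sub>E {1..n}.
      sgn_x n r (pair_labeling n \<phi> \<mu> \<nu>) *
      sgn_y n r (pair_labeling n \<phi> \<nu> \<pi>) *
      sgn_z n r (pair_labeling n \<phi> \<pi> \<mu>))"
proof -
  define L where "L = cube n \<rightarrow>\<^sub>E {1..n\<^sup>2}"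
  define M where "M = cube n \<rightarrow>\<^sub>E {1..n}"
  define s :: "_ \<Rightarrow> complex"
    where "s = (\<lambda>(\<alpha>, \<beta>, \<gamma>). of_int (sgn_x n r \<alpha> * sgn_y n r \<beta> * sgn_z n r \<gamma>))"
  define f where "f = (\<lambda>(\<mu>, \<nu>, \<pi>).
    (pair_labeling n \<phi> \<mu> \<nu>, pair_labeling n \<phi> \<nu> \<pi>, pair_labeling n \<phi> \<pi> \<mu>))"
  have "\<phi> \<in> {1..n} \<times> {1..n} \<rightarrow> {1..n\<^sup>2}"
    using assms(2) by (auto simp: bij_betw_def)
  then have "pair_labeling n \<phi> \<mu> \<nu> \<in> L" if "\<mu> \<in> M" "\<nu> \<in> M" for \<mu> \<nu>
    using that unfolding L_def M_def by (rule pair_labeling_in_PiE)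
  then have f: "f \<in> M \<times> M \<times> M \<rightarrow> L \<times> L \<times> L"
    by (auto simp: f_def)
  have fin: "finite (L \<times> L \<times> L)"
    by (auto simp: L_def intro!: finite_cartesian_product finite_PiE)
  have "fundamental_inv n r (matmul_tensor n \<phi>) =
      (\<Sum>\<alpha>\<in>L. \<Sum>\<beta>\<in>L. \<Sum>\<gamma>\<in>L. s (\<alpha>, \<beta>, \<gamma>) *
        (\<Sum>\<mu>\<in>M. \<Sum>\<nu>\<in>M. \<Sum>\<pi>\<in>M. of_bool ((\<alpha>, \<beta>, \<gamma>) = f (\<mu>, \<nu>, \<pi>))))"
    unfolding fundamental_inv_def L_def M_def
    by (intro sum.cong refl) (simp only: prod_matmul_tensor s_def f_def prod.case prod.inject)
  also have "\<dots> = (\<Sum>a\<in>L \<times> L \<times> L. s a * (\<Sum>b\<in>M \<times> M \<times> M. of_bool (a = f b)))"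
    by (simp add: sum.cartesian_product case_prod_unfold)
  also have "\<dots> = (\<Sum>b\<in>M \<times> M \<times> M. s (f b))"
    using fin f by (rule sum_times_fibre_count)
  also have "\<dots> = (\<Sum>\<mu>\<in>M. \<Sum>\<nu>\<in>M. \<Sum>\<pi>\<in>M. s (f (\<mu>, \<nu>, \<pi>)))"
    by (simp add: sum.cartesian_product case_prod_unfold)
  finally show ?thesis
    by (simp add: s_def f_def M_def)
qed

end
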